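(* Let $G=(G_1,\dots,G_N):\prod_{i=1}^N(\alpha_i,\beta_i)\to\mathbb R^N_{\ge0}$ satisfy (a), (b), (c) of the context, let $f_1,\dots,f_N,\delta$ be positive numbers with $f_i-\delta>0$ and $C_i>f_i$ for $i=2,\dots,N$, fix $b_1^0\in(\alpha_1,\beta_1)$, and let $W$ be as in the context. Assume $W\ne\emptyset$ and: (i) there exists $\alpha>0$ such that if $(b_1^0,b_2,\dots,b_N)\in W$, then $b_j\ge\alpha_j+\alpha$ for all $2\le j\le N$; (ii) given any positive $\delta_1,\dots,\delta_N$ there is a constant $M>0$ such that $G_i(\mathbf b-t\,\mathbf e_i)-G_i(\mathbf b)\le M\,t$ for all $1\le i\le N$, all $\mathbf b\in\prod_{k=1}^N[\alpha_k+\delta_k,\beta_k)$, and all $t$ with $\alpha_i<b_i-t\le b_i$ (where $\mathbf e_i$ is the $i$-th unit coordinate vector). Then, starting from any $\mathbf b^{1,1}\in W$, the iterative procedure described in the context can always be carried out, and it terminates in a finite number of steps: for any sequence of vectors $\mathbf b^{n,\ell}$ ($n\ge1$, $1\le\ell\le N$) produced by it there is $n_0$ such that $\mathbf b^{n_0,1}=\mathbf b^{n_0,2}=\cdots=\mathbf b^{n_0,N}$. The common vector $\mathbf b=\mathbf b^{n_0,1}\in W$ satisfies $$|G_j(\mathbf b)-f_j|\le\delta,\qquad 2\le j\le N.$$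
   Context: Hypotheses on $G$: (a) $G$ is continuous on $\prod_{i=1}^N(\alpha_i,\beta_i)$; (b) for each $1\le i\le N$ and $\alpha_i<s\le t<\beta_i$, $G_i(b_1,\dots,b_{i-1},t,b_{i+1},\dots,b_N)\le G_i(b_1,\dots,b_{i-1},s,b_{i+1},\dots,b_N)$ and $G_j(b_1,\dots,b_{i-1},t,b_{i+1},\dots,b_N)\ge G_j(b_1,\dots,b_{i-1},s,b_{i+1},\dots,b_N)$ for all $j\ne i$; (c) for each $1\le i\le N$ there is $C_i>0$ such that $\lim_{t\to\alpha_i^+}G_i(b_1,\dots,b_{i-1},t,b_{i+1},\dots,b_N)=C_i$ for all $\mathbf b=(b_1,\dots,b_N)$ in the box. The set $W$ is $$W=\Big\{\mathbf b=(b_1^0,b_2,\dots,b_N)\in\prod_{i=1}^N(\alpha_i,\beta_i):\ G_i(\mathbf b)\le f_i+\delta\ \text{for } i=2,\dots,N\Big\}.$$ Iterative procedure. Start from $\mathbf b^{1,1}\in W$. In stage $n$, given $\mathbf b^{n,1}\in W$, construct $\mathbf b^{n,2},\dots,\mathbf b^{n,N}$ successively: for $j=2,\dots,N$, if $f_j-\delta\le G_j(\mathbf b^{n,j-1})\le f_j+\delta$, set $\mathbf b^{n,j}=\mathbf b^{n,j-1}$; otherwise (in which case $G_j(\mathbf b^{n,j-1})<f_j-\delta$) let $\mathbf b^{n,j}\in W$ be a vector obtained from $\mathbf b^{n,j-1}$ by replacing only its $j$-th coordinate by a strictly smaller number in $(\alpha_j,\beta_j)$ so that $f_j\le G_j(\mathbf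 b^{n,j})\le f_j+\delta$. Then set $\mathbf b^{n+1,1}=\mathbf b^{n,N}$ and repeat. Here $N\ge2$. *)

theory Defs
  imports "HOL-Analysis.Analysis"
begin

(* Vectors of R^N are functions nat => real that are extensional on {1..N}. Their coordinates
   outside {1..N} are constant, so the product topology on nat => real induces the Euclidean
   topology on them. The upper endpoints \<beta> i may be infinite. The lower endpoints are real, since
   the theorem uses the numbers \<alpha> i + a. *)

definition open_box :: "nat \<Rightarrow> (nat \<Rightarrow> real) \<Rightarrow> (nat \<Rightarrow> ereal) \<Rightarrow> (nat \<Rightarrow> real) set" where
  "open_box N \<alpha> \<beta> = (\<Pi>\<^sub>E i\<in>{1..N}. {x. \<alpha> i < x \<and> ereal x < \<beta> i})"

definition half_open_box :: "nat \<Rightarrow> (nat \<Rightarrow> real) \<Rightarrow> (nat \<Rightarrow> ereal) \<Rightarrow> (nat \<Rightarrow> real) set" where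
  "half_open_box N \<alpha> \<beta> = (\<Pi>\<^sub>E i\<in>{1..N}. {x. \<alpha> i \<le> x \<and> ereal x < \<beta> i})"

definition W_set ::
  "nat \<Rightarrow> (nat \<Rightarrow> real) \<Rightarrow> (nat \<Rightarrow> ereal) \<Rightarrow> ((nat \<Rightarrow> real) \<Rightarrow> nat \<Rightarrow> real) \<Rightarrow> (nat \<Rightarrow> real) \<Rightarrow> real \<Rightarrow> real
    \<Rightarrow> (nat \<Rightarrow> real) set" where
  "W_set N \<alpha> \<beta> G f \<delta> b10 =
     {b \<in> open_box N \<alpha> \<beta>. b 1 = b10 \<and> (\<forall>i\<in>{2..N}. G b i \<le> f i + \<delta>)}"

(* The rule by which b' is chosen from b at coordinate j, with W the admissible set; it is a
   relation because the new j-th coordinate is not unique. The bound s < \<beta> j is implied by b' \<in> W. *)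
definition coord_step ::
  "(nat \<Rightarrow> real) set \<Rightarrow> (nat \<Rightarrow> real) \<Rightarrow> ((nat \<Rightarrow> real) \<Rightarrow> nat \<Rightarrow> real) \<Rightarrow> (nat \<Rightarrow> real) \<Rightarrow> real \<Rightarrow> nat
    \<Rightarrow> (nat \<Rightarrow> real) \<Rightarrow> (nat \<Rightarrow> real) \<Rightarrow> bool" where
  "coord_step W \<alpha> G f \<delta> j b b' \<longleftrightarrow>
     (if f j - \<delta> \<le> G b j \<and> G b j \<le> f j + \<delta> then b' = b
      else b' \<in> W \<and> (\<exists>s. \<alpha> j < s \<and> s < b j \<and> b' = b(j := s)) \<and>
           f j \<le> G b' j \<and> G b' j \<le> f j + \<delta>)"

(* reachable ... n l b: some finite initial part of the procedure, with arbitrary admissible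
   choices, ends with b at position l of stage n. *)
inductive reachable ::
  "nat \<Rightarrow> (nat \<Rightarrow> real) set \<Rightarrow> (nat \<Rightarrow> real) \<Rightarrow> ((nat \<Rightarrow> real) \<Rightarrow> nat \<Rightarrow> real) \<Rightarrow> (nat \<Rightarrow> real) \<Rightarrow> real
    \<Rightarrow> (nat \<Rightarrow> real) \<Rightarrow> nat \<Rightarrow> nat \<Rightarrow> (nat \<Rightarrow> real) \<Rightarrow> bool"
  for N W \<alpha> G f \<delta> b11 where
  start: "reachable N W \<alpha> G f \<delta> b11 1 1 b11"
| coord: "\<lbrakk>reachable N W \<alpha> G f \<delta> b11 n (j - 1) b; j \<in> {2..N}; coord_step W \<alpha> G f \<delta> j b b'\<rbrakk>
    \<Longrightarrow> reachable N W \<alpha> G f \<delta> b11 n j b'"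
| stage: "reachable N W \<alpha> G f \<delta> b11 n N b \<Longrightarrow> reachable N W \<alpha> G f \<delta> b11 (n + 1) 1 b"

(* B n l is the l-th vector of stage n; only n \<ge> 1 and l \<in> {1..N} are meaningful. *)
definition procedure_seq ::
  "nat \<Rightarrow> (nat \<Rightarrow> real) set \<Rightarrow> (nat \<Rightarrow> real) \<Rightarrow> ((nat \<Rightarrow> real) \<Rightarrow> nat \<Rightarrow> real) \<Rightarrow> (nat \<Rightarrow> real) \<Rightarrow> real
    \<Rightarrow> (nat \<Rightarrow> real) \<Rightarrow> (nat \<Rightarrow> nat \<Rightarrow> nat \<Rightarrow> real) \<Rightarrow> bool" where
  "procedure_seq N W \<alpha> G f \<delta> b11 B \<longleftrightarrow>
     B 1 1 = b11 \<and>
     (\<forall>n\<ge>1. (\<forall>j\<in>{2..N}. coord_step W \<alpha> G f \<delta> j (B n (j - 1)) (B n j)) \<and> B (n + 1) 1 = B n N)"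

end

(* Lowering coordinate j only lowers the G i with i different from j, so W is preserved, and the
   intermediate value theorem provides the admissible choice. A genuine change at j raises G j by
   more than \<delta>, hence by (ii) it lowers b j by more than \<delta> / M. As the coordinates are bounded
   below on W, only finitely many stages contain a genuine change. *)
theory Submission
  imports Defs
begin

section \<open>Intermediate values and one-coordinate updates in the box\<close>

text \<open>The limit \<open>c\<close> stands in for a value at \<open>a\<close>, where
  \<open>g\<close> need not be continuous: some \<open>t\<close> close to \<open>a\<close> has
  \<open>g t > y\<close>, and the intermediate value theorem applies on
  \<open>{t..b}\<close>.\<close>

lemma exists_value_of_tendsto_at_right:
  fixes g :: "real \<Rightarrow> real"
  assumes lim: "(g \<longlongrightarrow> c) (at_right a)" and cont: "continuous_on {a<..b} g"
    and "a < b" "g b < y" "y < c"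
  shows "\<exists>s. a < s \<and> s < b \<and> g s = y"
proof -
  have "\<forall>\<^sub>F t in at_right a. y < g t"
    using lim \<open>y < c\<close> by (rule order_tendstoD)
  then obtain u where u: "u > a" "\<And>t. a < t \<Longrightarrow> t < u \<Longrightarrow> y < g t"
    unfolding eventually_at_right_field by blast
  obtain t where t: "a < t" "t < min u b"
    using u(1) \<open>a < b\<close> dense[of a "min u b"] by auto
  have "continuous_on {t..b} g"
    using cont by (rule continuous_on_subset) (use t in auto)
  moreover have "y < g t" using u(2) t by simp
  ultimately obtain s where s: "t \<le> s" "s \<le> b" "g s = y"
    using IVT2'[of g b y t] t \<open>g b < y\<close> by auto
  moreover have "s \<noteq> b" using s \<open>g b < y\<close> by auto
  ultimately show ?thesis using t by (intro exI[of _ s]) auto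
qed

lemma open_box_fun_upd:
  assumes "b \<in> open_box N \<alpha> \<beta>" "j \<in> {1..N}" "\<alpha> j < s" "s \<le> b j"
  shows "b(j := s) \<in> open_box N \<alpha> \<beta>"
proof -
  have "ereal s < \<beta> j"
    using assms by (auto simp: open_box_def PiE_iff intro: le_less_trans[of "ereal s" "ereal (b j)"])
  then show ?thesis
    using assms by (auto simp: open_box_def PiE_iff extensional_def)
qed

lemma continuous_on_fun_upd:
  fixes b :: "'i \<Rightarrow> 'a::topological_space"
  shows "continuous_on S (\<lambda>t. b(j := t))"
proof (rule continuous_on_coordinatewise_then_product)
  fix i
  show "continuous_on S (\<lambda>t. (b(j := t)) i)"
    by (cases "i = j") auto
qed

section \<open>Steps and infinite runs of the procedure\<close>

text \<open>A correcting step strictly lowers coordinate \<open>j\<close>, so it can never return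
  \<open>b\<close> itself. This turns a constant stage into the final estimate.\<close>

lemma coord_step_self_iff:
  "coord_step W \<alpha> G f \<delta> j b b \<longleftrightarrow> \<bar>G b j - f j\<bar> \<le> \<delta>"
proof -
  have "b \<noteq> b(j := s)" if "s < b j" for s
    using that by (metis fun_upd_same less_irrefl)
  then show ?thesis
    unfolding coord_step_def by (auto simp: abs_le_iff)
qed

lemma coord_step_in:
  "coord_step W \<alpha> G f \<delta> j b b' \<Longrightarrow> b \<in> W \<Longrightarrow> b' \<in> W"
  unfolding coord_step_def by (auto split: if_splits)

lemma reachable_in:
  assumes "reachable N W \<alpha> G f \<delta> b11 n l b" "b11 \<in> W"
  shows "b \<in> W"
  using assms by (induction rule: reachable.induct) (auto dest: coord_step_in)

lemma procedure_seq_step: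
  assumes "procedure_seq N W \<alpha> G f \<delta> b11 B" "n \<ge> 1" "1 \<le> l" "l < N"
  shows "coord_step W \<alpha> G f \<delta> (Suc l) (B n l) (B n (Suc l))"
proof -
  have "Suc l \<in> {2..N}" using assms by simp
  then have "coord_step W \<alpha> G f \<delta> (Suc l) (B n (Suc l - 1)) (B n (Suc l))"
    using assms(1,2) unfolding procedure_seq_def by blast
  then show ?thesis by simp
qed

lemma procedure_seq_in:
  assumes B: "procedure_seq N W \<alpha> G f \<delta> b11 B" and "b11 \<in> W" "N \<ge> 1" "n \<ge> 1" "l \<in> {1..N}"
  shows "B n l \<in> W"
proof -
  \<comment> \<open>Membership is carried along one stage first; the induction over stages then only
    uses that \<open>B n N\<close> starts the next one.\<close>
  have row: "B n l \<in> W" if "B n 1 \<in> W" "n \<ge> 1" "1 \<le> l" "l \<le> N" for n l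
    using that(3,4)
  proof (induction l rule: dec_induct)
    case (step l)
    then have "coord_step W \<alpha> G f \<delta> (Suc l) (B n l) (B n (Suc l))"
      using procedure_seq_step[OF B that(2)] that(4) by simp
    then show ?case using step by (auto dest: coord_step_in)
  qed (use that in auto)
  have "B n 1 \<in> W"
    using \<open>n \<ge> 1\<close>
  proof (induction n rule: dec_induct)
    case base
    then show ?case using B \<open>b11 \<in> W\<close> by (simp add: procedure_seq_def)
  next
    case (step n)
    then have "B (Suc n) 1 = B n N" using B by (simp add: procedure_seq_def)
    then show ?case using row[of n N] step \<open>N \<ge> 1\<close> by simp
  qed
  then show ?thesis using row assms by auto
qed

text \<open>A fixed choice \<open>F\<close> of admissible successors makes the procedure
  deterministic, and the run is obtained by iterating it. Invariance of \<open>W\<close> keeps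
  \<open>F\<close> where successors exist.\<close>

lemma procedure_seq_exists:
  assumes ex: "\<And>j b. j \<in> {2..N} \<Longrightarrow> b \<in> W \<Longrightarrow> \<exists>b'. coord_step W \<alpha> G f \<delta> j b b'"
    and "b11 \<in> W" "N \<ge> 1"
  shows "\<exists>B. procedure_seq N W \<alpha> G f \<delta> b11 B"
proof -
  define F where "F j b = (SOME b'. coord_step W \<alpha> G f \<delta> j b b')" for j b
  have F: "coord_step W \<alpha> G f \<delta> j b (F j b)" if "j \<in> {2..N}" "b \<in> W" for j b
    unfolding F_def using ex[OF that] by (rule someI_ex)
  \<comment> \<open>\<open>R l b\<close> is the \<open>l\<close>-th vector of a stage that starts at
    \<open>b\<close>; the list is empty for \<open>l = 1\<close>.\<close>
  define R where "R l b = fold F [2..<Suc l] b" for l b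
  have R_1: "R 1 b = b" for b
    unfolding R_def by simp
  have R_Suc: "R (Suc l) b = F (Suc l) (R l b)" if "1 \<le> l" for l b
    using that unfolding R_def by simp
  have R_in: "R l b \<in> W" if "b \<in> W" "1 \<le> l" "l \<le> N" for l b
    using that(2,3)
  proof (induction l rule: dec_induct)
    case (step l)
    then show ?case using F[of "Suc l" "R l b"] by (auto simp: R_Suc dest: coord_step_in)
  qed (use that R_1 in auto)
  \<comment> \<open>The first vector of stage \<open>n\<close>. Stages count from 1, hence the
    exponent \<open>n - 1\<close>.\<close>
  define x where "x n = (R N ^^ (n - 1)) b11" for n
  have x_Suc: "x (n + 1) = R N (x n)" if "n \<ge> 1" for n
    using that by (cases n) (auto simp: x_def)
  have "(R N ^^ m) b11 \<in> W" for m
    by (induction m) (use assms R_in in auto)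
  then have x_in: "x n \<in> W" for n
    unfolding x_def .
  have "coord_step W \<alpha> G f \<delta> j (R (j - 1) (x n)) (R j (x n))" if "j \<in> {2..N}" for j n
  proof -
    have "R j (x n) = F j (R (j - 1) (x n))"
      using R_Suc[of "j - 1" "x n"] that by (cases j) auto
    then show ?thesis
      using F[OF that, of "R (j - 1) (x n)"] R_in[OF x_in, of "j - 1" n] that by (cases j) auto
  qed
  then have "procedure_seq N W \<alpha> G f \<delta> b11 (\<lambda>n l. R l (x n))"
    unfolding procedure_seq_def R_1 using x_Suc by (simp add: x_def)
  then show ?thesis by blast
qed

section \<open>Termination through a bounded quantity that drops\<close>

text \<open>Induction along the stage: the first genuine change costs \<open>S\<close> at least
  \<open>c\<close>, and no later step can raise \<open>S\<close> again because
  \<open>c \<ge> 0\<close>.\<close>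

lemma stage_constant_or_decrease:
  assumes B: "procedure_seq N W \<alpha> G f \<delta> b11 B" and "b11 \<in> W" "n \<ge> 1" "N \<ge> 1" "c \<ge> 0"
    and drop: "\<And>j b b'. \<lbrakk>j \<in> {2..N}; b \<in> W; coord_step W \<alpha> G f \<delta> j b b'; b' \<noteq> b\<rbrakk>
      \<Longrightarrow> S b' \<le> S b - (c::real)"
  shows "(\<forall>l\<in>{1..N}. B n l = B n 1) \<or> S (B (n + 1) 1) \<le> S (B n 1) - c"
proof -
  have "(\<forall>k\<in>{1..l}. B n k = B n 1) \<or> S (B n l) \<le> S (B n 1) - c" if "1 \<le> l" "l \<le> N" for l
    using that
  proof (induction l rule: dec_induct)
    case base
    show ?case by simp
  next
    case (step l)
    have l: "1 \<le> l" "l < N" using step.hyps step.prems by simp_all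
    have s: "coord_step W \<alpha> G f \<delta> (Suc l) (B n l) (B n (Suc l))"
      using procedure_seq_step[OF B \<open>n \<ge> 1\<close> l] .
    have "B n l \<in> W"
      using procedure_seq_in[OF B \<open>b11 \<in> W\<close> \<open>N \<ge> 1\<close> \<open>n \<ge> 1\<close>, of l] l by simp
    then have d: "B n (Suc l) = B n l \<or> S (B n (Suc l)) \<le> S (B n l) - c"
      using drop[OF _ _ s] l by auto
    consider "\<forall>k\<in>{1..l}. B n k = B n 1" | "S (B n l) \<le> S (B n 1) - c"
      using step.IH[OF less_imp_le[OF l(2)]] by blast
    then show ?case
    proof cases
      case 1
      then have eq: "B n l = B n 1" by (rule bspec) (use l in simp)
      show ?thesis
      proof (cases "B n (Suc l) = B n l")
        case True
        have "B n k = B n 1" if k: "k \<in> {1..Suc l}" for k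
        proof (cases "k = Suc l")
          case False
          then have "k \<in> {1..l}" using k by simp
          then show ?thesis by (rule bspec[OF 1])
        qed (simp only: True eq)
        then show ?thesis by blast
      next
        case False
        with d show ?thesis unfolding eq by blast
      qed
    next
      case 2
      then show ?thesis using d \<open>c \<ge> 0\<close> by fastforce
    qed
  qed
  from this[OF \<open>N \<ge> 1\<close> order_refl] B \<open>n \<ge> 1\<close> show ?thesis
    unfolding procedure_seq_def by metis
qed

text \<open>If no stage were constant, each would lower \<open>S\<close> by at least
  \<open>c > 0\<close>, and by the Archimedean property \<open>S\<close> would fall below
  \<open>L\<close>.\<close>

lemma exists_constant_stage:
  assumes B: "procedure_seq N W \<alpha> G f \<delta> b11 B" and "b11 \<in> W" "N \<ge> 1" "c > 0"
    and drop: "\<And>j b b'. \<lbrakk>j \<in> {2..N}; b \<in> W; coord_step W \<alpha> G f \<delta> j b b'; b' \<noteq> b\<rbrakk>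
      \<Longrightarrow> S b' \<le> S b - (c::real)"
    and lower: "\<And>b. b \<in> W \<Longrightarrow> L \<le> S b"
  shows "\<exists>n0\<ge>1. \<forall>l\<in>{1..N}. B n0 l = B n0 1"
proof (rule ccontr)
  assume contra: "\<not> ?thesis"
  have decr: "S (B (n + 1) 1) \<le> S (B n 1) - c" if "n \<ge> 1" for n
  proof -
    have "\<not> (\<forall>l\<in>{1..N}. B n l = B n 1)" using contra that by blast
    moreover have "0 \<le> c" using \<open>c > 0\<close> by simp
    ultimately show ?thesis
      using stage_constant_or_decrease[OF B \<open>b11 \<in> W\<close> that \<open>N \<ge> 1\<close>, of c S] drop by blast
  qed
  have up: "S (B (Suc m) 1) \<le> S (B 1 1) - real m * c" for m
  proof (induction m)
    case (Suc m)
    then show ?case using decr[of "Suc m"] by (simp add: algebra_simps)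
  qed simp
  have "L \<le> S (B (Suc m) 1)" for m
    using lower procedure_seq_in[OF B \<open>b11 \<in> W\<close> \<open>N \<ge> 1\<close>, of "Suc m" 1] \<open>N \<ge> 1\<close> by simp
  from order_trans[OF this up] have "real m * c \<le> S (B 1 1) - L" for m
    by (simp add: algebra_simps)
  then show False
    using reals_Archimedean3[OF \<open>c > 0\<close>] by (meson not_less)
qed

text \<open>The conjunct on \<open>reachable\<close> rules out that some earlier choice blocks a
  later step; the existence of one run \<open>B\<close> alone would not. Passing from position
  \<open>N\<close> to the next stage is always possible, hence the restriction
  \<open>l < N\<close>.\<close>

theorem mainTheorem2:
  fixes N :: nat
    and \<alpha> :: "nat \<Rightarrow> real" and \<beta> :: "nat \<Rightarrow> ereal"
    and G :: "(nat \<Rightarrow> real) \<Rightarrow> nat \<Rightarrow> real"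
    and C f :: "nat \<Rightarrow> real" and \<delta> b10 :: real
    and W :: "(nat \<Rightarrow> real) set" and b11 :: "nat \<Rightarrow> real"
  defines "W \<equiv> W_set N \<alpha> \<beta> G f \<delta> b10"
  assumes N: "N \<ge> 2"
    and G_range: "G \<in> open_box N \<alpha> \<beta> \<rightarrow> (\<Pi>\<^sub>E i\<in>{1..N}. {0..})"
    and G_cont: "continuous_on (open_box N \<alpha> \<beta>) G"
    and G_mono: "\<And>i s t b. \<lbrakk>i \<in> {1..N}; \<alpha> i < s; s \<le> t; ereal t < \<beta> i; b \<in> open_box N \<alpha> \<beta>\<rbrakk> \<Longrightarrow>
      G (b(i := t)) i \<le> G (b(i := s)) i \<and>
      (\<forall>j\<in>{1..N} - {i}. G (b(i := t)) j \<ge> G (b(i := s)) j)"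
    and C_pos: "\<And>i. i \<in> {1..N} \<Longrightarrow> C i > 0"
    and G_lim: "\<And>i b. \<lbrakk>i \<in> {1..N}; b \<in> open_box N \<alpha> \<beta>\<rbrakk> \<Longrightarrow>
      ((\<lambda>t. G (b(i := t)) i) \<longlongrightarrow> C i) (at_right (\<alpha> i))"
    and f_pos: "\<And>i. i \<in> {1..N} \<Longrightarrow> f i > 0"
    and delta_pos: "\<delta> > 0"
    and f_delta: "\<And>i. i \<in> {2..N} \<Longrightarrow> f i - \<delta> > 0"
    and C_f: "\<And>i. i \<in> {2..N} \<Longrightarrow> C i > f i"
    and b10: "\<alpha> 1 < b10" "ereal b10 < \<beta> 1"
    and W_nonempty: "W \<noteq> {}"
    and W_lower: "\<exists>a>0. \<forall>b\<in>W. \<forall>j\<in>{2..N}. b j \<ge> \<alpha> j + a"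
    and G_lipschitz: "\<And>d :: nat \<Rightarrow> real. (\<And>k. k \<in> {1..N} \<Longrightarrow> d k > 0) \<Longrightarrow>
      \<exists>M>0. \<forall>i\<in>{1..N}. \<forall>b\<in>half_open_box N (\<lambda>k. \<alpha> k + d k) \<beta>. \<forall>t.
        \<alpha> i < b i - t \<and> b i - t \<le> b i \<longrightarrow> G (b(i := b i - t)) i - G b i \<le> M * t"
    and b11: "b11 \<in> W"
  shows
    "(\<forall>n l b. reachable N W \<alpha> G f \<delta> b11 n l b \<longrightarrow>
        b \<in> W \<and> (l < N \<longrightarrow> (\<exists>b'. coord_step W \<alpha> G f \<delta> (l + 1) b b'))) \<and>
     (\<exists>B. procedure_seq N W \<alpha> G f \<delta> b11 B) \<and>
     (\<forall>B. procedure_seq N W \<alpha> G f \<delta> b11 B \<longrightarrow>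
        (\<exists>n0\<ge>1. \<forall>l\<in>{1..N}. B n0 l = B n0 1) \<and>
        (\<forall>n0\<ge>1. (\<forall>l\<in>{1..N}. B n0 l = B n0 1) \<longrightarrow>
           B n0 1 \<in> W \<and> (\<forall>j\<in>{2..N}. \<bar>G (B n0 1) j - f j\<bar> \<le> \<delta>)))"
proof -
  have W_iff: "b \<in> W \<longleftrightarrow> b \<in> open_box N \<alpha> \<beta> \<and> b 1 = b10 \<and> (\<forall>i\<in>{2..N}. G b i \<le> f i + \<delta>)" for b
    by (simp add: W_def W_set_def)
  have step_ex: "\<exists>b'. coord_step W \<alpha> G f \<delta> j b b'" if j: "j \<in> {2..N}" and b: "b \<in> W" for j b
  proof (cases "f j - \<delta> \<le> G b j")
    case True
    then show ?thesis
      using b j by (intro exI[of _ b]) (auto simp: coord_step_def W_iff)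
  next
    case False
    have box: "b \<in> open_box N \<alpha> \<beta>" using b by (simp add: W_iff)
    have j1: "j \<in> {1..N}" using j by auto
    have bj: "\<alpha> j < b j" "ereal (b j) < \<beta> j"
      using box j1 by (auto simp: open_box_def PiE_iff)
    have upd: "b(j := s) \<in> open_box N \<alpha> \<beta>" if "\<alpha> j < s" "s \<le> b j" for s
      using open_box_fun_upd[OF box j1 that] .
    have "continuous_on {\<alpha> j<..b j} (\<lambda>t. G (b(j := t)))"
      by (rule continuous_on_compose2[OF G_cont continuous_on_fun_upd]) (use upd in auto)
    then have "continuous_on {\<alpha> j<..b j} (\<lambda>t. G (b(j := t)) j)"
      by (rule continuous_on_product_then_coordinatewise)
    \<comment> \<open>The target is \<open>f j\<close>, the lowest admissible value: it lies above
      \<open>G b j\<close> and below the limit \<open>C j\<close>, whereas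
      \<open>f j + \<delta>\<close> may exceed \<open>C j\<close>.\<close>
    from exists_value_of_tendsto_at_right[OF G_lim[OF j1 box] this bj(1), of "f j"]
    obtain s where s: "\<alpha> j < s" "s < b j" "G (b(j := s)) j = f j"
      using False delta_pos C_f[OF j] by auto
    \<comment> \<open>For \<open>i\<close> other than \<open>j\<close>, monotonicity compares
      \<open>s\<close> with the old value, \<open>b(j := b j)\<close> being \<open>b\<close> itself;
      for \<open>i = j\<close> the value is \<open>f j\<close>.\<close>
    have "G (b(j := s)) i \<le> f i + \<delta>" if i: "i \<in> {2..N}" for i
    proof (cases "i = j")
      case False
      then have "G (b(j := s)) i \<le> G (b(j := b j)) i"
        using G_mono[OF j1 s(1) _ bj(2) box] s(2) i by auto
      also have "\<dots> \<le> f i + \<delta>" using b i by (simp add: W_iff)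
      finally show ?thesis .
    qed (use s delta_pos in auto)
    then have "b(j := s) \<in> W"
      using upd[of s] s b j by (auto simp: W_iff)
    then show ?thesis
      using False s delta_pos by (intro exI[of _ "b(j := s)"]) (auto simp: coord_step_def)
  qed
  obtain a where a: "a > 0" "\<And>b j. b \<in> W \<Longrightarrow> j \<in> {2..N} \<Longrightarrow> b j \<ge> \<alpha> j + a"
    using W_lower by blast
  \<comment> \<open>These margins put all of \<open>W\<close> into one half-open box, so a single
    \<open>M\<close> serves every step. Coordinate 1 is frozen at \<open>b10\<close>, which is then
    its lower endpoint.\<close>
  define d where "d k = (if k = 1 then b10 - \<alpha> 1 else a)" for k :: nat
  have "d k > 0" for k
    using a b10 by (simp add: d_def)
  with G_lipschitz[of d] obtain M where M: "M > 0"
    "\<And>i b t. \<lbrakk>i \<in> {1..N}; b \<in> half_open_box N (\<lambda>k. \<alpha> k + d k) \<beta>; \<alpha> i < b i - t; b i - t \<le> b i\<rbrakk>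
      \<Longrightarrow> G (b(i := b i - t)) i - G b i \<le> M * t"
    by blast
  have half: "b \<in> half_open_box N (\<lambda>k. \<alpha> k + d k) \<beta>" if "b \<in> W" for b
    using that a(2)[OF that] by (auto simp: W_iff d_def half_open_box_def open_box_def PiE_iff)
  \<comment> \<open>The quantity that drops: the sum of the coordinates that the procedure may
    change.\<close>
  define S where "S b = (\<Sum>j\<in>{2..N}. b j)" for b :: "nat \<Rightarrow> real"
  have drop: "S b' \<le> S b - \<delta> / M"
    if j: "j \<in> {2..N}" and b: "b \<in> W" and st: "coord_step W \<alpha> G f \<delta> j b b'" "b' \<noteq> b" for j b b'
  proof -
    \<comment> \<open>Membership in \<open>W\<close> excludes overshooting, so a genuine change
      starts below \<open>f j - \<delta>\<close> and ends at or above \<open>f j\<close>.\<close>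
    have "G b j \<le> f j + \<delta>" using b j by (auto simp: W_iff)
    then have low: "G b j < f j - \<delta>"
      using st by (auto simp: coord_step_def split: if_splits)
    then obtain s where s: "\<alpha> j < s" "s < b j" "b' = b(j := s)" "f j \<le> G b' j"
      using st(1) by (auto simp: coord_step_def)
    \<comment> \<open>The bound with \<open>t = b j - s\<close>; only the starting vector
      \<open>b\<close> has to lie in the half-open box.\<close>
    have "G b' j - G b j \<le> M * (b j - s)"
      using M(2)[OF _ half[OF b], of j "b j - s"] j s by auto
    then have "\<delta> \<le> M * (b j - s)" using low s(4) by linarith
    then have "\<delta> / M \<le> b j - s" using M(1) by (simp add: field_simps)
    moreover have "S b' = S b - (b j - s)"
      unfolding S_def using j s(3) sum.remove[of "{2..N}" j b] sum.remove[of "{2..N}" j b'] by simp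
    ultimately show ?thesis by simp
  qed
  have lower: "(\<Sum>j\<in>{2..N}. \<alpha> j) \<le> S b" if "b \<in> W" for b
    unfolding S_def using a(1) a(2)[OF that] by (intro sum_mono) force
  have stop: "B n 1 \<in> W \<and> (\<forall>j\<in>{2..N}. \<bar>G (B n 1) j - f j\<bar> \<le> \<delta>)"
    if B: "procedure_seq N W \<alpha> G f \<delta> b11 B" and n: "n \<ge> 1" and eq: "\<forall>l\<in>{1..N}. B n l = B n 1" for B n
  proof (intro conjI ballI)
    show "B n 1 \<in> W" using procedure_seq_in[OF B b11 _ n] N by simp
    fix j assume j: "j \<in> {2..N}"
    have "coord_step W \<alpha> G f \<delta> j (B n (j - 1)) (B n j)"
      using B n j by (simp add: procedure_seq_def)
    \<comment> \<open>In a constant stage, step \<open>j\<close> maps \<open>B n 1\<close> to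
      itself, which happens only within tolerance.\<close>
    moreover have "B n (j - 1) = B n 1" "B n j = B n 1"
      by (rule bspec[OF eq], use j in force)+
    ultimately show "\<bar>G (B n 1) j - f j\<bar> \<le> \<delta>"
      using coord_step_self_iff[of W \<alpha> G f \<delta> j "B n 1"] by simp
  qed
  have fin: "\<exists>n0\<ge>1. \<forall>l\<in>{1..N}. B n0 l = B n0 1" if "procedure_seq N W \<alpha> G f \<delta> b11 B" for B
    by (rule exists_constant_stage[OF that b11 _ _ drop lower]) (use N delta_pos M in auto)
  \<comment> \<open>Ensures that the next coordinate \<open>l + 1\<close> is at least 2, as
    \<open>step_ex\<close> requires.\<close>
  have pos: "1 \<le> l" if "reachable N W \<alpha> G f \<delta> b11 n l b" for n l b
    using that by (induction rule: reachable.induct) auto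
  have reach: "b \<in> W \<and> (l < N \<longrightarrow> (\<exists>b'. coord_step W \<alpha> G f \<delta> (l + 1) b b'))"
    if "reachable N W \<alpha> G f \<delta> b11 n l b" for n l b
    using reachable_in[OF that b11] pos[OF that] step_ex[of "l + 1" b] by auto
  have ex: "\<exists>B. procedure_seq N W \<alpha> G f \<delta> b11 B"
    by (rule procedure_seq_exists[OF step_ex b11]) (use N in auto)
  show ?thesis
    by (intro conjI[OF _ conjI] allI impI conjI[OF fin] ex) ((rule reach | rule stop), assumption+)+
qed

end
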